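(* Let $k$ be a field of characteristic $p>0$, let $(R,\mathfrak{m})$ be an $\mathbb{N}^n$-graded local finitely generated $k$-algebra, let $I$ be an $\mathfrak{m}$-primary homogeneous ideal generated in degree at most $\delta\in\mathbb{N}^n$, and let $s\geq 1$ be a real number. If $x\in R$ is a homogeneous element with $\deg x\neq (0,\ldots,0)$ and $\deg x\geq s\delta$, then $x\in I^{\{s\}}$.
   Context: All rings are commutative and noetherian; inequalities between vectors in $\mathbb{R}^n$ are componentwise. "$(R,\mathfrak{m})$ graded local" means that $R$ is graded with unique homogeneous maximal ideal $\mathfrak{m}$. "Generated in degree at most $\delta$" means that $I$ has a set of homogeneous generators each of degree $\leq\delta$. $R^\circ$ denotes the set of elements of $R$ lying in no minimal prime of $R$. The letter $q$ denotes positive integer powers of $p$, and $q\gg 0$ means all sufficiently large such powers. $I^{[q]}=(f^q\mid f\in I)$ is the $q$th Frobenius power of $I$. For a real number $s\geq 1$, $I^{(s,q)}=I^{\lceil sq\rceil}+I^{[q]}$, and the weak $s$-closure $I^{\{s\}}$ is the ideal of all $x\in R$ for which there exists $c\in R^\circ$ such that $cx^q\in I^{(s,q)}$ for all $q\gg 0$. *)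

theory Defs
  imports
    "HOL-Analysis.Finite_Cartesian_Product"
    "HOL-Algebra.Module"
    "HOL-Algebra.Ideal_Product"
    "HOL-Algebra.Generated_Rings"
    "HOL-Algebra.Ring_Divisibility"
begin

text \<open>The characteristic of a ring object (the library constant \<open>CHAR\<close> is for type classes only).\<close>

definition ring_char :: "('a, 'b) ring_scheme \<Rightarrow> nat" where
  "ring_char R =
     (if \<exists>n::nat. 0 < n \<and> [n] \<cdot>\<^bsub>R\<^esub> \<one>\<^bsub>R\<^esub> = \<zero>\<^bsub>R\<^esub>
      then LEAST n::nat. 0 < n \<and> [n] \<cdot>\<^bsub>R\<^esub> \<one>\<^bsub>R\<^esub> = \<zero>\<^bsub>R\<^esub>
      else 0)"

definition finitely_generated_algebra ::
    "('k, 'b) ring_scheme \<Rightarrow> ('k, 'a, 'c) module_scheme \<Rightarrow> bool" where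
  "finitely_generated_algebra k R \<longleftrightarrow>
     algebra k R \<and>
     (\<exists>S. finite S \<and> S \<subseteq> carrier R \<and>
          generate_ring R ((\<lambda>a. a \<odot>\<^bsub>R\<^esub> \<one>\<^bsub>R\<^esub>) ` carrier k \<union> S) = carrier R)"

text \<open>
  A grading of a \<open>k\<close>-algebra \<open>R\<close> by the monoid of vectors of natural numbers: \<open>R\<close> is the
  direct sum of the \<open>k\<close>-subspaces \<open>grade d\<close>. As the pieces are subspaces, \<open>k\<close> sits in degree 0;
  that \<open>\<one>\<close> has degree 0 follows from the axioms. The zero element lies in every piece.
\<close>

locale multigraded_algebra = algebra k R
  for k :: "('k, 'b) ring_scheme" and R :: "('k, 'a, 'c) module_scheme" +
  fixes grade :: "nat ^ 'n \<Rightarrow> 'a set"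
  assumes grade_submodule: "submodule (grade d) k R"
    and grade_mult: "\<lbrakk>x \<in> grade d; y \<in> grade e\<rbrakk> \<Longrightarrow> x \<otimes>\<^bsub>R\<^esub> y \<in> grade (d + e)"
    and grade_decomposition:
      "x \<in> carrier R \<Longrightarrow>
         \<exists>!f. (\<forall>d. f d \<in> grade d) \<and> finite {d. f d \<noteq> \<zero>\<^bsub>R\<^esub>} \<and>
              x = (\<Oplus>\<^bsub>R\<^esub>d\<in>{d. f d \<noteq> \<zero>\<^bsub>R\<^esub>}. f d)"

definition homogeneous_ideal ::
    "('a, 'b) ring_scheme \<Rightarrow> (nat ^ 'n \<Rightarrow> 'a set) \<Rightarrow> 'a set \<Rightarrow> bool" where
  "homogeneous_ideal R grade J \<longleftrightarrow> ideal J R \<and> J = genideal R (J \<inter> (\<Union>d. grade d))"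

definition generated_in_degree_at_most ::
    "('a, 'b) ring_scheme \<Rightarrow> (nat ^ 'n \<Rightarrow> 'a set) \<Rightarrow> nat ^ 'n \<Rightarrow> 'a set \<Rightarrow> bool" where
  "generated_in_degree_at_most R grade \<delta> I \<longleftrightarrow>
     (\<exists>G. G \<subseteq> (\<Union>d\<in>{d. d \<le> \<delta>}. grade d) \<and> I = genideal R G)"

definition graded_local ::
    "('a, 'b) ring_scheme \<Rightarrow> (nat ^ 'n \<Rightarrow> 'a set) \<Rightarrow> 'a set \<Rightarrow> bool" where
  "graded_local R grade \<mm> \<longleftrightarrow> {J. maximalideal J R \<and> homogeneous_ideal R grade J} = {\<mm>}"

definition ideal_radical :: "('a, 'b) ring_scheme \<Rightarrow> 'a set \<Rightarrow> 'a set" where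
  "ideal_radical R I = {x \<in> carrier R. \<exists>n::nat. x [^]\<^bsub>R\<^esub> n \<in> I}"

definition primary_ideal :: "('a, 'b) ring_scheme \<Rightarrow> 'a set \<Rightarrow> bool" where
  "primary_ideal R I \<longleftrightarrow>
     ideal I R \<and> I \<noteq> carrier R \<and>
     (\<forall>a\<in>carrier R. \<forall>b\<in>carrier R. a \<otimes>\<^bsub>R\<^esub> b \<in> I \<longrightarrow> a \<in> I \<or> b \<in> ideal_radical R I)"

definition primary_to :: "('a, 'b) ring_scheme \<Rightarrow> 'a set \<Rightarrow> 'a set \<Rightarrow> bool" where
  "primary_to R \<mm> I \<longleftrightarrow> primary_ideal R I \<and> ideal_radical R I = \<mm>"

definition minimal_primes :: "('a, 'b) ring_scheme \<Rightarrow> 'a set set" where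
  "minimal_primes R =
     {P. primeideal P R \<and> (\<forall>Q. primeideal Q R \<longrightarrow> Q \<subseteq> P \<longrightarrow> Q = P)}"

text \<open>The set usually written \<open>R\<close> with a superscript circle.\<close>

definition avoiding_minimal_primes :: "('a, 'b) ring_scheme \<Rightarrow> 'a set" where
  "avoiding_minimal_primes R = {c \<in> carrier R. \<forall>P\<in>minimal_primes R. c \<notin> P}"

definition frobenius_power :: "('a, 'b) ring_scheme \<Rightarrow> 'a set \<Rightarrow> nat \<Rightarrow> 'a set" where
  "frobenius_power R I q = genideal R ((\<lambda>f. f [^]\<^bsub>R\<^esub> q) ` I)"

text \<open>
  The ideal \<open>I\<^sup>(\<^sup>s\<^sup>,\<^sup>q\<^sup>)\<close>. Ordinary powers of ideals are powers in the multiplicative monoid of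
  \<open>ideals_set R\<close>. The conversion to \<open>nat\<close> is harmless because \<open>s \<ge> 1\<close>.
\<close>

definition mixed_power :: "('a, 'b) ring_scheme \<Rightarrow> real \<Rightarrow> nat \<Rightarrow> 'a set \<Rightarrow> 'a set" where
  "mixed_power R s q I =
     (I [^]\<^bsub>ideals_set R\<^esub> nat \<lceil>s * real q\<rceil>) <+>\<^bsub>R\<^esub> frobenius_power R I q"

text \<open>The weak \<open>s\<close>-closure in characteristic \<open>p\<close>; \<open>q = p ^ e\<close> runs over the large powers of \<open>p\<close>.\<close>

definition weak_closure :: "('a, 'b) ring_scheme \<Rightarrow> nat \<Rightarrow> real \<Rightarrow> 'a set \<Rightarrow> 'a set" where
  "weak_closure R p s I =
     {x \<in> carrier R. \<exists>c\<in>avoiding_minimal_primes R.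
        \<forall>\<^sub>F e in sequentially. c \<otimes>\<^bsub>R\<^esub> (x [^]\<^bsub>R\<^esub> (p ^ e)) \<in> mixed_power R s (p ^ e) I}"

end

theory Submission
  imports Defs
begin

text \<open>
  The membership holds already with the summand \<open>I\<^sup>\<lceil>\<^sup>s\<^sup>q\<^sup>\<rceil>\<close> of \<open>I\<^sup>(\<^sup>s\<^sup>,\<^sup>q\<^sup>)\<close>, and it comes from counting
  degrees.

  Fix a coordinate \<open>i\<close> with \<open>d\<^sub>i > 0\<close>. Homogeneous elements of nonzero degree lie in \<open>\<mm>\<close>, the
  radical of \<open>I\<close>, and from this one gets a bound \<open>B\<close> such that every homogeneous element of \<open>i\<close>-degree
  above \<open>B\<close> lies in \<open>I\<close> (\<open>large_degree_in_ideal\<close>). Since the generators of \<open>I\<close> have \<open>i\<close>-degree at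
  most \<open>\<delta>\<^sub>i\<close>, splitting off one generator at a time shows that \<open>i\<close>-degree above \<open>B + M \<delta>\<^sub>i\<close> forces
  membership in \<open>I\<^sup>M\<close> (\<open>large_degree_in_ideal_power\<close>). The element \<open>x\<^sup>q\<close> has \<open>i\<close>-degree
  \<open>q d\<^sub>i \<ge> s q \<delta>\<^sub>i\<close>, so for large \<open>q\<close> it lies in \<open>I\<^sup>M\<close> with \<open>M = \<lceil>s q\<rceil> - (B + 2)\<close>: the loss in the exponent does not
  depend on \<open>q\<close>. Multiplying by an element \<open>c\<close> of \<open>I\<^sup>B\<^sup>+\<^sup>2\<close> makes up for it.

  It remains to find \<open>c\<close> outside all minimal primes (\<open>nilpotent_or_regular_element_in_power\<close>).
  Either \<open>I\<^sup>B\<^sup>+\<^sup>2\<close> contains an element that is regular modulo the intersection of all primes, and such an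
  element lies in no minimal prime; or some \<open>w\<close> outside this intersection multiplies \<open>I\<^sup>B\<^sup>+\<^sup>2\<close>, hence
  also \<open>\<mm>\<close>, into it. Then \<open>w \<notin> \<mm>\<close>, since otherwise \<open>w\<^sup>2\<close> would be nilpotent, and \<open>w x\<close> is nilpotent.
  The degree zero component of a power of \<open>w\<close> is a unit because \<open>\<mm>\<close> is the only homogeneous maximal
  ideal, so \<open>x\<close> is nilpotent, and \<open>c = \<one>\<close> works.
\<close>

section \<open>Noetherian commutative rings\<close>

lemma (in cring) idealI_cring:
  assumes "J \<subseteq> carrier R" and "\<zero> \<in> J"
    and "\<And>a b. a \<in> J \<Longrightarrow> b \<in> J \<Longrightarrow> a \<oplus> b \<in> J"
    and mult: "\<And>r a. r \<in> carrier R \<Longrightarrow> a \<in> J \<Longrightarrow> r \<otimes> a \<in> J"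
  shows "ideal J R"
proof (rule idealI)
  show "ring R" by (rule ring_axioms)
  have "\<ominus> a \<in> J" if "a \<in> J" for a
    using mult[of "\<ominus> \<one>" a] that assms(1) by (auto simp: l_minus subset_iff)
  then show "subgroup J (add_monoid R)"
    using assms by (intro subgroup.intro) (auto simp: a_inv_def[symmetric])
  show "r \<otimes> a \<in> J" if "a \<in> J" "r \<in> carrier R" for a r
    using that mult by blast
  show "a \<otimes> r \<in> J" if "a \<in> J" "r \<in> carrier R" for a r
    using that mult[of r a] assms(1) m_comm[of r a] by auto
qed

lemma (in cring) ideal_plus_principal:
  assumes "ideal L R" "y \<in> carrier R"
  shows "ideal {l \<oplus> y \<otimes> r | l r. l \<in> L \<and> r \<in> carrier R} R" (is "ideal ?J R")
    and "L \<subseteq> {l \<oplus> y \<otimes> r | l r. l \<in> L \<and> r \<in> carrier R}"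
    and "y \<in> {l \<oplus> y \<otimes> r | l r. l \<in> L \<and> r \<in> carrier R}"
proof -
  interpret L: ideal L R by fact
  show L: "L \<subseteq> ?J"
  proof
    fix l assume "l \<in> L"
    then have "l = l \<oplus> y \<otimes> \<zero>" using assms(2) L.Icarr by simp
    then show "l \<in> ?J" using \<open>l \<in> L\<close> by blast
  qed
  have "y = \<zero> \<oplus> y \<otimes> \<one>" using assms(2) by simp
  then show "y \<in> ?J" using L.zero_closed by blast
  show "ideal ?J R"
  proof (rule idealI_cring)
    show "?J \<subseteq> carrier R" using assms(2) L.Icarr by auto
    show "\<zero> \<in> ?J" using L L.zero_closed by blast
  next
    fix a b assume "a \<in> ?J" "b \<in> ?J"
    then obtain l r l' r' where *: "l \<in> L" "l' \<in> L" "r \<in> carrier R" "r' \<in> carrier R"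
      "a = l \<oplus> y \<otimes> r" "b = l' \<oplus> y \<otimes> r'" by blast
    then have "a \<oplus> b = (l \<oplus> l') \<oplus> y \<otimes> (r \<oplus> r')"
      using assms(2) L.Icarr by (simp add: r_distr a_ac)
    then show "a \<oplus> b \<in> ?J" using * L.a_closed by blast
  next
    fix t a assume "t \<in> carrier R" "a \<in> ?J"
    then obtain l r where *: "l \<in> L" "r \<in> carrier R" "a = l \<oplus> y \<otimes> r" by blast
    then have "t \<otimes> a = (t \<otimes> l) \<oplus> y \<otimes> (t \<otimes> r)"
      using assms(2) L.Icarr \<open>t \<in> carrier R\<close> by (simp add: r_distr m_ac)
    then show "t \<otimes> a \<in> ?J" using * L.I_l_closed \<open>t \<in> carrier R\<close> by blast
  qed
qed

locale noetherian_cring = noetherian_ring + cring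

text \<open>
  The form in which the noetherian property is used throughout: Zorn's lemma applies to any family of
  ideals, as the union of a chain is one of its members.
\<close>

lemma (in noetherian_ring) maximal_ideal_in_family:
  assumes "L \<in> F" and "\<And>J. J \<in> F \<Longrightarrow> ideal J R"
  obtains M where "M \<in> F" "L \<subseteq> M" "\<And>J. J \<in> F \<Longrightarrow> M \<subseteq> J \<Longrightarrow> J = M"
proof -
  have "\<exists>M\<in>{J\<in>F. L \<subseteq> J}. \<forall>J\<in>{J\<in>F. L \<subseteq> J}. M \<subseteq> J \<longrightarrow> J = M"
  proof (rule subset_Zorn)
    fix C assume C: "subset.chain {J \<in> F. L \<subseteq> J} C"
    show "\<exists>U\<in>{J \<in> F. L \<subseteq> J}. \<forall>J\<in>C. J \<subseteq> U"
    proof (cases "C = {}")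
      case True
      then show ?thesis using assms(1) by auto
    next
      case False
      have "subset.chain {I. ideal I R} C"
        using C assms(2) unfolding pred_on.chain_def by blast
      from ideal_chain_is_trivial[OF False this] have "\<Union>C \<in> {J \<in> F. L \<subseteq> J}"
        using C unfolding pred_on.chain_def by (elim conjE) (rule subsetD)
      then show ?thesis by (rule bexI[rotated]) blast
    qed
  qed
  then obtain M where "M \<in> {J\<in>F. L \<subseteq> J}"
    and max: "\<forall>J\<in>{J\<in>F. L \<subseteq> J}. M \<subseteq> J \<longrightarrow> J = M"
    by (rule bexE)
  then have M: "M \<in> F" "L \<subseteq> M" by simp_all
  show ?thesis
  proof (rule that[OF M])
    show "J = M" if "J \<in> F" "M \<subseteq> J" for J
      using max that order_trans[OF M(2) that(2)] by simp
  qed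
qed

lemma (in noetherian_ring) proper_ideal_in_maximalideal:
  assumes "ideal J R" "\<one> \<notin> J"
  obtains M where "maximalideal M R" "J \<subseteq> M"
proof -
  let ?F = "{J. ideal J R \<and> \<one> \<notin> J}"
  have "J \<in> ?F" using assms by simp
  then obtain M where "M \<in> ?F" and M: "J \<subseteq> M"
    and max: "\<And>A. A \<in> ?F \<Longrightarrow> M \<subseteq> A \<Longrightarrow> A = M"
    by (rule maximal_ideal_in_family, simp) (rule that)
  then have M': "ideal M R" "\<one> \<notin> M" by simp_all
  have "maximalideal M R"
  proof (rule maximalidealI)
    show "carrier R \<noteq> M" using M'(2) one_closed by metis
    show "A = M \<or> A = carrier R" if "ideal A R" "M \<subseteq> A" for A
      using max[of A] that ideal.one_imp_carrier[of A R] by auto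
  qed (rule M')
  then show ?thesis using that M by blast
qed

text \<open>
  An ideal that is maximal among those disjoint from \<open>S\<close> is prime: if neither \<open>a\<close> nor \<open>b\<close> lies in it,
  adjoining either one yields an element of \<open>S\<close>, and the product of the two elements lies in the
  ideal as soon as \<open>a \<otimes> b\<close> does.
\<close>

lemma (in noetherian_cring) primeideal_avoiding_mult_set:
  assumes "\<one> \<in> S" "\<zero> \<notin> S" "\<And>a b. a \<in> S \<Longrightarrow> b \<in> S \<Longrightarrow> a \<otimes> b \<in> S"
  obtains P where "primeideal P R" "P \<inter> S = {}"
proof -
  let ?F = "{J. ideal J R \<and> J \<inter> S = {}}"
  have "{\<zero>} \<in> ?F" using assms(2) zeroideal by auto
  then obtain P where P: "ideal P R" "P \<inter> S = {}"
    and max: "\<And>J. J \<in> ?F \<Longrightarrow> P \<subseteq> J \<Longrightarrow> J = P"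
    by (rule maximal_ideal_in_family) auto
  interpret P: ideal P R by fact
  have meets: "\<exists>l\<in>P. \<exists>r\<in>carrier R. l \<oplus> a \<otimes> r \<in> S" if "a \<in> carrier R" "a \<notin> P" for a
    using max[OF _ ideal_plus_principal(2)[OF P(1) that(1)]]
      ideal_plus_principal(1,3)[OF P(1) that(1)] that(2) by blast
  have "primeideal P R"
  proof (rule primeidealI)
    show "carrier R \<noteq> P" using P(2) assms(1) by auto
    fix a b assume ab: "a \<in> carrier R" "b \<in> carrier R" "a \<otimes> b \<in> P"
    show "a \<in> P \<or> b \<in> P"
    proof (rule ccontr)
      assume "\<not> (a \<in> P \<or> b \<in> P)"
      then obtain l r l' r' where *: "l \<in> P" "r \<in> carrier R" "l \<oplus> a \<otimes> r \<in> S"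
        "l' \<in> P" "r' \<in> carrier R" "l' \<oplus> b \<otimes> r' \<in> S"
        using meets ab by meson
      have "(l \<oplus> a \<otimes> r) \<otimes> (l' \<oplus> b \<otimes> r') =
        (l' \<oplus> b \<otimes> r') \<otimes> l \<oplus> (a \<otimes> r \<otimes> l' \<oplus> r \<otimes> r' \<otimes> (a \<otimes> b))"
        using * ab P.Icarr by (simp add: l_distr r_distr m_ac a_ac)
      also have "\<dots> \<in> P"
        using * ab P.Icarr P.I_l_closed[OF ab(3), of "r \<otimes> r'"]
        by (intro P.a_closed P.I_l_closed[OF *(1)] P.I_l_closed[OF *(4)]) auto
      finally show False using P(2) assms(3)[OF *(3,6)] by blast
    qed
  qed (use P is_cring in auto)
  then show ?thesis using that P(2) by blast
qed

text \<open>
  The nilradical. As an intersection of primes it is visibly a radical ideal; that its elements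
  are nilpotent is \<open>nilpotent_if_prime_radical\<close> below.
\<close>

definition (in ring) prime_radical :: "'a set" where
  "prime_radical = {z \<in> carrier R. \<forall>P. primeideal P R \<longrightarrow> z \<in> P}"

lemma (in cring) prime_radical_ideal: "ideal prime_radical R"
proof (rule idealI_cring)
  show "\<zero> \<in> prime_radical"
    unfolding prime_radical_def
    by (auto simp: primeideal_def ideal_def intro: additive_subgroup.zero_closed)
  show "a \<oplus> b \<in> prime_radical" if "a \<in> prime_radical" "b \<in> prime_radical" for a b
    using that unfolding prime_radical_def
    by (auto simp: primeideal_def ideal_def intro: additive_subgroup.a_closed)
  show "r \<otimes> a \<in> prime_radical" if "r \<in> carrier R" "a \<in> prime_radical" for r a
    using that unfolding prime_radical_def
    by (auto simp: primeideal_def intro: ideal.I_l_closed)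
qed (auto simp: prime_radical_def)

lemma (in primeideal) pow_mem:
  "a \<in> carrier R \<Longrightarrow> a [^] (n::nat) \<in> I \<Longrightarrow> a \<in> I"
proof (induction n)
  case 0
  then show ?case using one_imp_carrier I_notcarr by simp
next
  case (Suc n)
  then show ?case using I_prime[of "a [^] n" a] by auto
qed

lemma (in cring) prime_radical_mult_pow:
  assumes "w \<in> carrier R" "a \<in> carrier R" "w \<otimes> a [^] (n::nat) \<in> prime_radical"
  shows "w \<otimes> a \<in> prime_radical"
  unfolding prime_radical_def
proof safe
  fix P assume "primeideal P R"
  then interpret P: primeideal P R .
  have "w \<in> P \<or> a [^] n \<in> P"
    using assms \<open>primeideal P R\<close> by (intro P.I_prime) (auto simp: prime_radical_def)
  then show "w \<otimes> a \<in> P"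
    using P.pow_mem assms P.I_l_closed P.I_r_closed by blast
qed (use assms in auto)

lemma (in noetherian_cring) nilpotent_if_prime_radical:
  assumes "z \<in> prime_radical"
  shows "\<exists>n::nat. z [^] n = \<zero>"
proof (rule ccontr)
  assume *: "\<not> ?thesis"
  have z: "z \<in> carrier R" using assms by (simp add: prime_radical_def)
  obtain P where P: "primeideal P R" "P \<inter> range (\<lambda>n::nat. z [^] n) = {}"
  proof (rule primeideal_avoiding_mult_set)
    show "\<one> \<in> range (\<lambda>n::nat. z [^] n)" by (metis nat_pow_0 rangeI)
    show "\<zero> \<notin> range (\<lambda>n::nat. z [^] n)" using * by auto
    show "a \<otimes> b \<in> range (\<lambda>n::nat. z [^] n)"
      if "a \<in> range (\<lambda>n::nat. z [^] n)" "b \<in> range (\<lambda>n::nat. z [^] n)" for a b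
      using that nat_pow_mult[OF z] by auto
  qed auto
  have "z [^] (1::nat) = z" using z by simp
  then have "z \<notin> P" using P(2) by (metis disjoint_iff rangeI)
  then show False using assms P(1) by (simp add: prime_radical_def)
qed

text \<open>
  This is nilpotency of the maximal ideal in the localization at a minimal prime \<open>P\<close>. Were \<open>\<zero>\<close> not
  among the products \<open>w c\<^sup>n\<close> with \<open>w \<notin> P\<close>, a prime avoiding all of them would be contained in \<open>P\<close>
  without containing \<open>c\<close>.
\<close>

lemma (in noetherian_cring) minimal_prime_annihilator:
  assumes P: "P \<in> minimal_primes R" and c: "c \<in> P"
  shows "\<exists>w\<in>carrier R - P. \<exists>n::nat. w \<otimes> c [^] n = \<zero>"
proof (rule ccontr)
  assume *: "\<not> ?thesis"
  interpret P: primeideal P R using P by (simp add: minimal_primes_def)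
  have cc: "c \<in> carrier R" using c P.Icarr by blast
  let ?S = "{w \<otimes> c [^] (n::nat) | w n. w \<in> carrier R - P}"
  have one: "\<one> \<in> carrier R - P" using P.one_imp_carrier P.I_notcarr by auto
  obtain Q where Q: "primeideal Q R" "Q \<inter> ?S = {}"
  proof (rule primeideal_avoiding_mult_set)
    have "\<one> = \<one> \<otimes> c [^] (0::nat)" by simp
    then show "\<one> \<in> ?S" using one by blast
    show "\<zero> \<notin> ?S"
    proof
      assume "\<zero> \<in> ?S"
      then obtain w n where "w \<in> carrier R - P" "\<zero> = w \<otimes> c [^] (n::nat)" by blast
      then show False using * by metis
    qed
    fix a b assume "a \<in> ?S" "b \<in> ?S"
    then obtain w m v n where ab: "w \<in> carrier R - P" "v \<in> carrier R - P"
      "a = w \<otimes> c [^] (m::nat)" "b = v \<otimes> c [^] (n::nat)" by blast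
    then have "a \<otimes> b = (w \<otimes> v) \<otimes> c [^] (m + n)"
      using cc by (simp add: nat_pow_mult[symmetric] m_ac)
    moreover have "w \<otimes> v \<in> carrier R - P" using ab P.I_prime by auto
    ultimately show "a \<otimes> b \<in> ?S" by blast
  qed auto
  interpret Q: primeideal Q R by fact
  have "w \<otimes> c [^] (0::nat) \<in> ?S" if "w \<in> carrier R - P" for w using that by blast
  then have "w \<in> ?S" if "w \<in> carrier R - P" for w using that by simp
  then have "Q \<subseteq> P" using Q(2) Q.Icarr by blast
  then have "Q = P" using P Q(1) by (simp add: minimal_primes_def)
  have "\<one> \<otimes> c [^] (1::nat) \<in> ?S" using one by blast
  then have "c \<in> ?S" using cc by simp
  then show False using c \<open>Q = P\<close> Q(2) by blast
qed

lemma (in noetherian_cring) regular_mod_prime_radical_avoids_minimal_primes: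
  assumes c: "c \<in> carrier R"
    and reg: "\<And>w. w \<in> carrier R \<Longrightarrow> w \<otimes> c \<in> prime_radical \<Longrightarrow> w \<in> prime_radical"
  shows "c \<in> avoiding_minimal_primes R"
  unfolding avoiding_minimal_primes_def
proof (safe intro!: c)
  fix P assume P: "P \<in> minimal_primes R" and "c \<in> P"
  then obtain w n where w: "w \<in> carrier R" "w \<notin> P" "w \<otimes> c [^] (n::nat) = \<zero>"
    using minimal_prime_annihilator by blast
  have "\<zero> \<in> prime_radical"
    using prime_radical_ideal by (auto simp: ideal_def additive_subgroup.zero_closed)
  then have "w \<in> prime_radical"
    using w prime_radical_mult_pow[of w c n] reg[of w] c by simp
  then show False using P w by (simp add: minimal_primes_def prime_radical_def)
qed

definition (in ring) annihilator_mod_prime_radical :: "'a set \<Rightarrow> 'a set" where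
  "annihilator_mod_prime_radical A = {z \<in> carrier R. \<forall>a\<in>A. z \<otimes> a \<in> prime_radical}"

lemma (in cring) annihilator_mod_prime_radical_ideal:
  assumes "A \<subseteq> carrier R"
  shows "ideal (annihilator_mod_prime_radical A) R"
proof -
  interpret N: ideal prime_radical R by (rule prime_radical_ideal)
  show ?thesis
    by (rule idealI_cring)
      (use assms N.a_closed N.I_l_closed N.zero_closed in
        \<open>auto simp: annihilator_mod_prime_radical_def l_distr m_assoc subset_iff\<close>)
qed

text \<open>
  In a reduced noetherian ring an ideal with zero annihilator contains a nonzerodivisor; the lemma
  says this of the quotient by the prime radical. Choose \<open>c \<in> L\<close> whose double annihilator is maximal. If a nonzero \<open>w\<close>
  kills \<open>c\<close>, take \<open>y \<in> L\<close> with \<open>w y \<noteq> 0\<close>. Whatever kills \<open>c + w y\<close> kills \<open>c\<^sup>2\<close>, hence \<open>c\<close>, so the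
  double annihilator of \<open>c + w y\<close> is at least as large and by maximality equal. So \<open>w\<close> kills
  \<open>c + w y\<close> as well, that is \<open>w\<^sup>2 y = 0\<close>, contradicting reducedness.
\<close>

lemma (in noetherian_cring) regular_element_mod_prime_radical:
  assumes L: "ideal L R"
    and faithful: "\<And>w. w \<in> carrier R \<Longrightarrow> (\<forall>y\<in>L. w \<otimes> y \<in> prime_radical) \<Longrightarrow> w \<in> prime_radical"
  obtains c where "c \<in> L"
    "\<And>w. w \<in> carrier R \<Longrightarrow> w \<otimes> c \<in> prime_radical \<Longrightarrow> w \<in> prime_radical"
proof -
  interpret N: ideal prime_radical R by (rule prime_radical_ideal)
  interpret L: ideal L R by fact
  let ?ann = annihilator_mod_prime_radical
  have ann_carr: "?ann A \<subseteq> carrier R" for A by (auto simp: annihilator_mod_prime_radical_def)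
  have "?ann (?ann {\<zero>}) \<in> (\<lambda>c. ?ann (?ann {c})) ` L" using L.zero_closed by blast
  then obtain M where M: "M \<in> (\<lambda>c. ?ann (?ann {c})) ` L"
    and max: "\<And>J. J \<in> (\<lambda>c. ?ann (?ann {c})) ` L \<Longrightarrow> M \<subseteq> J \<Longrightarrow> J = M"
    by (rule maximal_ideal_in_family) (use annihilator_mod_prime_radical_ideal ann_carr in auto)
  from M obtain c where c: "c \<in> L" "M = ?ann (?ann {c})" by blast
  have cc: "c \<in> carrier R" using c L.Icarr by blast
  have "w \<in> prime_radical" if w: "w \<in> carrier R" "w \<otimes> c \<in> prime_radical" for w
  proof (rule ccontr)
    assume "w \<notin> prime_radical"
    then obtain y where y: "y \<in> L" "w \<otimes> y \<notin> prime_radical" using faithful w(1) by blast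
    have yc: "y \<in> carrier R" using y L.Icarr by blast
    define c' where "c' = c \<oplus> w \<otimes> y"
    have c': "c' \<in> L" using c y w by (simp add: c'_def L.a_closed L.I_l_closed)
    have sub: "z \<in> ?ann {c}" if z: "z \<in> ?ann {c'}" for z
    proof -
      have zc: "z \<in> carrier R" "z \<otimes> c' \<in> prime_radical"
        using z by (auto simp: annihilator_mod_prime_radical_def)
      have "z \<otimes> c [^] (2::nat) = c \<otimes> (z \<otimes> c') \<oplus> (\<ominus> (z \<otimes> y)) \<otimes> (w \<otimes> c)"
        unfolding c'_def numeral_2_eq_2 using zc(1) w(1) cc yc by (simp, algebra)
      also have "\<dots> \<in> prime_radical"
        using zc w cc yc by (intro N.a_closed N.I_l_closed[OF zc(2)] N.I_l_closed[OF w(2)]) auto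
      finally have "z \<otimes> c \<in> prime_radical" using prime_radical_mult_pow zc cc by blast
      then show ?thesis using zc by (simp add: annihilator_mod_prime_radical_def)
    qed
    then have "?ann (?ann {c}) \<subseteq> ?ann (?ann {c'})"
      by (auto simp: annihilator_mod_prime_radical_def)
    then have eq: "?ann (?ann {c'}) = ?ann (?ann {c})" using max c c' by blast
    \<comment> \<open>\<open>w\<close> kills \<open>c\<close>, so it kills the double annihilator of \<open>c\<close>, to which \<open>c'\<close> belongs.\<close>
    have "c' \<in> ?ann (?ann {c'})"
      using c' L.Icarr by (auto simp: annihilator_mod_prime_radical_def m_comm)
    moreover have "w \<in> ?ann {c}" using w by (simp add: annihilator_mod_prime_radical_def)
    ultimately have "c' \<otimes> w \<in> prime_radical"
      unfolding eq by (simp add: annihilator_mod_prime_radical_def)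
    then have "c' \<otimes> w \<oplus> (\<ominus> \<one>) \<otimes> (w \<otimes> c) \<in> prime_radical"
      using w by (intro N.a_closed N.I_l_closed[OF w(2)]) auto
    also have "c' \<otimes> w \<oplus> (\<ominus> \<one>) \<otimes> (w \<otimes> c) = y \<otimes> w [^] (2::nat)"
      unfolding c'_def numeral_2_eq_2 using w(1) cc yc by (simp, algebra)
    finally have "y \<otimes> w \<in> prime_radical" using prime_radical_mult_pow w yc by blast
    then show False using y(2) m_comm[OF yc w(1)] by simp
  qed
  then show ?thesis using that c(1) by blast
qed


section \<open>Powers of ideals\<close>

context cring
begin

lemma ideals_set_mult_one [simp]:
  "A \<otimes>\<^bsub>ideals_set R\<^esub> B = A \<cdot> B" "\<one>\<^bsub>ideals_set R\<^esub> = carrier R"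
  by (simp_all add: ideals_set_def)

lemma ideal_power_ideal:
  "ideal J R \<Longrightarrow> ideal (J [^]\<^bsub>ideals_set R\<^esub> (n::nat)) R"
  by (induction n) (auto simp: oneideal ideal_prod_is_ideal)

lemma ideal_power_add:
  assumes "ideal J R"
  shows "J [^]\<^bsub>ideals_set R\<^esub> (m + n :: nat) = (J [^]\<^bsub>ideals_set R\<^esub> m) \<cdot> (J [^]\<^bsub>ideals_set R\<^esub> n)"
  using assms ideal_power_ideal[OF assms, of m] ideal_power_ideal[OF assms]
  by (induction n) (simp_all add: ideal_prod_one ideal_prod_assoc)

lemma ideal_power_mult:
  assumes "ideal J R" "a \<in> J [^]\<^bsub>ideals_set R\<^esub> (m::nat)" "b \<in> J [^]\<^bsub>ideals_set R\<^esub> n"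
  shows "a \<otimes> b \<in> J [^]\<^bsub>ideals_set R\<^esub> (m + n)"
  using assms by (simp add: ideal_power_add ideal_prod.prod)

lemma ideal_power_antimono:
  assumes "ideal J R" "m \<le> n"
  shows "J [^]\<^bsub>ideals_set R\<^esub> n \<subseteq> J [^]\<^bsub>ideals_set R\<^esub> (m::nat)"
  using ideal_prod_inter[OF ideal_power_ideal[OF assms(1), of m]
      ideal_power_ideal[OF assms(1), of "n - m"]]
    ideal_power_add[OF assms(1), of m "n - m"] assms(2) by simp

lemma pow_in_ideal_power:
  "ideal J R \<Longrightarrow> a \<in> J \<Longrightarrow> a [^] (n::nat) \<in> J [^]\<^bsub>ideals_set R\<^esub> n"
  by (induction n) (auto simp: ideal_prod.prod)

end

section \<open>Rings graded by vectors of natural numbers\<close>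

text \<open>
  The grading of a multigraded algebra expressed in terms of the ring \<open>R\<close> alone, with the graded pieces
  as additive subgroups, so that the ring notation refers to a single structure.
\<close>

locale multigraded_ring = cring R for R (structure) +
  fixes grade :: "nat ^ 'n \<Rightarrow> 'a set"
  assumes grade_subgroup: "additive_subgroup (grade d) R"
    and grade_mult: "\<lbrakk>x \<in> grade d; y \<in> grade e\<rbrakk> \<Longrightarrow> x \<otimes> y \<in> grade (d + e)"
    and grade_decomposition:
      "x \<in> carrier R \<Longrightarrow>
         \<exists>!f. (\<forall>d. f d \<in> grade d) \<and> finite {d. f d \<noteq> \<zero>} \<and>
              x = (\<Oplus>d\<in>{d. f d \<noteq> \<zero>}. f d)"
begin

lemma grade_carrier: "x \<in> grade d \<Longrightarrow> x \<in> carrier R"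
  using additive_subgroup.a_Hcarr[OF grade_subgroup] .

lemma grade_zero: "\<zero> \<in> grade d"
  using additive_subgroup.zero_closed[OF grade_subgroup] .

lemma grade_add: "x \<in> grade d \<Longrightarrow> y \<in> grade d \<Longrightarrow> x \<oplus> y \<in> grade d"
  using additive_subgroup.a_closed[OF grade_subgroup] .

definition component :: "'a \<Rightarrow> nat ^ 'n \<Rightarrow> 'a" where
  "component x = (THE f. (\<forall>d. f d \<in> grade d) \<and> finite {d. f d \<noteq> \<zero>} \<and>
              x = (\<Oplus>d\<in>{d. f d \<noteq> \<zero>}. f d))"

lemma component_props:
  assumes "x \<in> carrier R"
  shows "component x d \<in> grade d" "finite {d. component x d \<noteq> \<zero>}"
    "x = (\<Oplus>d\<in>{d. component x d \<noteq> \<zero>}. component x d)"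
  using theI'[OF grade_decomposition[OF assms]] unfolding component_def[symmetric] by auto

lemma component_closed: "x \<in> carrier R \<Longrightarrow> component x d \<in> carrier R"
  using component_props(1) grade_carrier by blast

lemma component_eqI:
  assumes f: "\<And>d. f d \<in> grade d" and A: "finite A" "\<And>d. d \<notin> A \<Longrightarrow> f d = \<zero>"
    and x: "x = (\<Oplus>d\<in>A. f d)"
  shows "component x = f"
proof -
  have sub: "{d. f d \<noteq> \<zero>} \<subseteq> A" using A(2) by auto
  have fc: "f d \<in> carrier R" for d using f grade_carrier by blast
  have "x = (\<Oplus>d\<in>{d. f d \<noteq> \<zero>}. f d)"
    unfolding x by (rule add.finprod_mono_neutral_cong_right) (use A sub fc in auto)
  moreover have "finite {d. f d \<noteq> \<zero>}" using sub A(1) finite_subset by blast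
  moreover have "x \<in> carrier R" unfolding x using fc by (intro finsum_closed) auto
  ultimately show ?thesis
    unfolding component_def using f by (intro the1_equality grade_decomposition) auto
qed

lemma component_sum:
  assumes "x \<in> carrier R" "finite A" "\<And>d. d \<notin> A \<Longrightarrow> component x d = \<zero>"
  shows "x = (\<Oplus>d\<in>A. component x d)"
proof -
  have "{d. component x d \<noteq> \<zero>} \<subseteq> A" using assms(3) by auto
  then have "(\<Oplus>d\<in>{d. component x d \<noteq> \<zero>}. component x d) = (\<Oplus>d\<in>A. component x d)"
    by (intro add.finprod_mono_neutral_cong_left)
      (use assms component_closed in auto)
  then show ?thesis using component_props(3)[OF assms(1)] by simp
qed

lemma component_homogeneous:
  assumes "x \<in> grade d"
  shows "component x e = (if e = d then x else \<zero>)"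
proof -
  have "component x = (\<lambda>e. if e = d then x else \<zero>)"
    by (rule component_eqI[of _ "{d}"]) (use assms grade_zero grade_carrier in auto)
  then show ?thesis by simp
qed

lemma component_add:
  assumes "x \<in> carrier R" "y \<in> carrier R"
  shows "component (x \<oplus> y) d = component x d \<oplus> component y d"
proof -
  let ?A = "{d. component x d \<noteq> \<zero>} \<union> {d. component y d \<noteq> \<zero>}"
  have fin: "finite ?A" using component_props(2) assms by auto
  have "x = (\<Oplus>d\<in>?A. component x d)" "y = (\<Oplus>d\<in>?A. component y d)"
    using assms fin by (intro component_sum; auto)+
  then have "x \<oplus> y = (\<Oplus>d\<in>?A. component x d) \<oplus> (\<Oplus>d\<in>?A. component y d)" by simp
  also have "\<dots> = (\<Oplus>d\<in>?A. component x d \<oplus> component y d)"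
    using assms component_closed by (intro finsum_addf[symmetric]) auto
  finally have "component (x \<oplus> y) = (\<lambda>d. component x d \<oplus> component y d)"
    by (intro component_eqI[OF _ fin]) (use assms component_props(1) grade_add in auto)
  then show ?thesis by simp
qed

text \<open>
  Multiplication by a homogeneous element shifts the grading. Subtraction of degrees truncates,
  whence the case distinction: nothing of degree \<open>e\<close> arises unless \<open>f \<le> e\<close>.
\<close>

lemma component_mult_homogeneous:
  assumes g: "g \<in> grade f" and r: "r \<in> carrier R"
  shows "component (g \<otimes> r) e = (if f \<le> e then g \<otimes> component r (e - f) else \<zero>)"
proof -
  let ?A = "{d. component r d \<noteq> \<zero>}"
  let ?h = "\<lambda>e. if f \<le> e then g \<otimes> component r (e - f) else \<zero>"
  have gc: "g \<in> carrier R" using g grade_carrier by blast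
  have fin: "finite ?A" using component_props(2) r by auto
  have sub: "f + (e - f) = e" if "f \<le> e" for e
    using that by (simp add: vec_eq_iff less_eq_vec_def)
  have sub': "f + d - f = d" "f \<le> f + d" for d
    by (simp_all add: vec_eq_iff less_eq_vec_def)
  have h: "?h e \<in> grade e" for e
    using grade_mult[OF g component_props(1)[OF r], of "e - f"] sub grade_zero by auto
  have "g \<otimes> r = g \<otimes> (\<Oplus>d\<in>?A. component r d)" using component_props(3)[OF r] by simp
  also have "\<dots> = (\<Oplus>d\<in>?A. g \<otimes> component r d)"
    using component_closed[OF r] by (intro finsum_rdistr[OF fin gc]) auto
  also have "\<dots> = (\<Oplus>d\<in>?A. ?h (f + d))" by (simp add: sub')
  also have "\<dots> = (\<Oplus>e\<in>(+) f ` ?A. ?h e)"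
    by (rule add.finprod_reindex[symmetric])
      (use gc r component_closed in \<open>auto intro!: inj_onI\<close>)
  finally have eq: "g \<otimes> r = (\<Oplus>e\<in>(+) f ` ?A. ?h e)" .
  have "component (g \<otimes> r) = ?h"
  proof (rule component_eqI[OF h _ _ eq])
    show "finite ((+) f ` ?A)" using fin by simp
    fix e assume e: "e \<notin> (+) f ` ?A"
    show "?h e = \<zero>"
    proof (cases "f \<le> e")
      case True
      then have "e - f \<notin> ?A" using e sub[OF True] by (metis imageI)
      then show ?thesis using True gc by simp
    qed simp
  qed
  then show ?thesis by simp
qed

text \<open>
  Comparing degrees in \<open>z \<otimes> \<one> = z\<close> for homogeneous \<open>z\<close> shows that the degree zero component of \<open>\<one>\<close>
  acts as the identity on all homogeneous elements, and so equals \<open>\<one>\<close>.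
\<close>

lemma one_homogeneous: "\<one> \<in> grade 0"
proof -
  define u where "u = component \<one> 0"
  have u: "u \<in> grade 0" using component_props(1) by (simp add: u_def)
  have uc: "u \<in> carrier R" using u grade_carrier by blast
  have "z \<otimes> u = z" if "z \<in> grade d" for z d
    using component_mult_homogeneous[OF that, of \<one> d] component_homogeneous[OF that, of d]
      grade_carrier[OF that] by (simp add: u_def)
  then have eq: "component \<one> d \<otimes> u = component \<one> d" for d
    using component_props(1) by blast
  let ?A = "{d. component \<one> d \<noteq> \<zero>}"
  have "\<one> \<otimes> u = (\<Oplus>d\<in>?A. component \<one> d) \<otimes> u" using component_props(3)[of \<one>] by simp
  also have "\<dots> = (\<Oplus>d\<in>?A. component \<one> d \<otimes> u)"
    using component_closed component_props(2) uc by (intro finsum_ldistr) auto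
  also have "\<dots> = \<one>" using component_props(3)[of \<one>] by (simp add: eq)
  finally show ?thesis using u uc by simp
qed

lemma grade_pow:
  assumes "x \<in> grade d"
  shows "x [^] (n::nat) \<in> grade (\<chi> i. n * d $ i)"
proof (induction n)
  case 0
  then show ?case using one_homogeneous by (simp add: zero_vec_def)
next
  case (Suc n)
  have "(\<chi> i. n * d $ i) + d = (\<chi> i. Suc n * d $ i)" by (simp add: vec_eq_iff)
  then show ?case using grade_mult[OF Suc assms] by simp
qed

lemma components_in_ideal:
  assumes J: "ideal J R" and z: "z \<in> carrier R" and "\<And>d. component z d \<in> J"
  shows "z \<in> J"
proof -
  interpret J: ideal J R by fact
  have "finite A \<Longrightarrow> (\<Oplus>d\<in>A. component z d) \<in> J" for A
    by (induction A rule: finite_induct)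
      (use assms component_closed J.a_closed J.zero_closed in auto)
  from this[OF component_props(2)[OF z]] show ?thesis using component_props(3)[OF z] by simp
qed

text \<open>
  Elements of a generated ideal are sums of products \<open>g \<otimes> r\<close>, whose component of degree \<open>e\<close> is
  \<open>g\<close> times a component of \<open>r\<close>, so it suffices to control such products. The proof avoids sums: the
  elements all of whose multiples have components in \<open>K\<close> in the degrees from \<open>E\<close> form an ideal.
\<close>

lemma component_genideal:
  assumes G: "G \<subseteq> (\<Union>d. grade d)" and K: "ideal K R"
    and gen: "\<And>g f r e. g \<in> G \<Longrightarrow> g \<in> grade f \<Longrightarrow> r \<in> carrier R \<Longrightarrow> e \<in> E \<Longrightarrow> f \<le> e \<Longrightarrow>
        g \<otimes> component r (e - f) \<in> K"
    and z: "z \<in> Idl G" and e: "e \<in> E"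
  shows "component z e \<in> K"
proof -
  interpret K: ideal K R by fact
  let ?H = "{z \<in> carrier R. \<forall>r\<in>carrier R. \<forall>e\<in>E. component (r \<otimes> z) e \<in> K}"
  have "ideal ?H R"
  proof (rule idealI_cring)
    have "component \<zero> e = \<zero>" for e using component_homogeneous[OF grade_zero] by simp
    then show "\<zero> \<in> ?H" using K.zero_closed by simp
    show "a \<oplus> b \<in> ?H" if "a \<in> ?H" "b \<in> ?H" for a b
      using that K.a_closed by (simp add: r_distr component_add)
    show "r \<otimes> a \<in> ?H" if "r \<in> carrier R" "a \<in> ?H" for r a
      using that by (simp add: m_assoc[symmetric])
  qed auto
  moreover have "G \<subseteq> ?H"
  proof
    fix g assume g: "g \<in> G"
    then obtain f where f: "g \<in> grade f" using G by blast
    have "component (g \<otimes> r) e \<in> K" if "r \<in> carrier R" "e \<in> E" for r e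
      using component_mult_homogeneous[OF f that(1)] gen[OF g f that] K.zero_closed by simp
    then show "g \<in> ?H" using grade_carrier[OF f] by (simp add: m_comm)
  qed
  ultimately have "z \<in> ?H" using genideal_minimal[of ?H G] z by blast
  then have "component (\<one> \<otimes> z) e \<in> K" using e by blast
  then show ?thesis using \<open>z \<in> ?H\<close> by simp
qed

lemma component_homogeneous_ideal:
  assumes "homogeneous_ideal R grade J" "z \<in> J"
  shows "component z e \<in> J"
proof (rule component_genideal[where E = UNIV])
  show J: "ideal J R" using assms by (simp add: homogeneous_ideal_def)
  show "z \<in> Idl (J \<inter> (\<Union>d. grade d))" using assms by (simp add: homogeneous_ideal_def)
  show "g \<otimes> component r (e - f) \<in> J"
    if "g \<in> J \<inter> (\<Union>d. grade d)" "r \<in> carrier R" for g f r e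
    using that ideal.I_r_closed[OF J] component_closed by blast
qed auto

lemma homogeneous_idealI:
  assumes J: "ideal J R" and comp: "\<And>z e. z \<in> J \<Longrightarrow> component z e \<in> J"
  shows "homogeneous_ideal R grade J"
proof -
  let ?G = "J \<inter> (\<Union>d. grade d)"
  have Jc: "J \<subseteq> carrier R" using ideal.Icarr[OF J] by blast
  have id: "ideal (Idl ?G) R" using Jc by (intro genideal_ideal) auto
  have G: "?G \<subseteq> Idl ?G" using Jc by (intro genideal_self) auto
  have "component z e \<in> Idl ?G" if "z \<in> J" for z e
  proof (rule subsetD[OF G])
    have "component z e \<in> grade e" using component_props(1) Jc that by blast
    then show "component z e \<in> ?G" using comp[OF that] by blast
  qed
  then have "J \<subseteq> Idl ?G" using components_in_ideal[OF id] Jc by blast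
  moreover have "Idl ?G \<subseteq> J" using J by (intro genideal_minimal) auto
  ultimately show ?thesis using J by (auto simp: homogeneous_ideal_def)
qed

section \<open>Homogeneous maximal ideals\<close>

text \<open>
  Otherwise \<open>\<one> = l + z r\<close> with \<open>l \<in> M\<close>. As \<open>z r\<close> has no component of degree zero, \<open>\<one>\<close> is the degree
  zero component of \<open>l\<close> and lies in \<open>M\<close>.
\<close>

lemma grade_nonzero_in_maximalideal:
  assumes M: "maximalideal M R" "homogeneous_ideal R grade M"
    and z: "z \<in> grade e" "e \<noteq> 0"
  shows "z \<in> M"
proof (rule ccontr)
  assume "z \<notin> M"
  interpret M: maximalideal M R by fact
  have zc: "z \<in> carrier R" using z grade_carrier by blast
  note J = ideal_plus_principal[OF M.is_ideal zc]
  have "{l \<oplus> z \<otimes> r | l r. l \<in> M \<and> r \<in> carrier R} = carrier R"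
    using M.I_maximal[OF J(1,2)] J(3) \<open>z \<notin> M\<close> ideal.Icarr[OF J(1)] by blast
  then have "\<one> \<in> {l \<oplus> z \<otimes> r | l r. l \<in> M \<and> r \<in> carrier R}" by simp
  then obtain l r where lr: "l \<in> M" "r \<in> carrier R" "\<one> = l \<oplus> z \<otimes> r" by blast
  have "\<not> e \<le> 0" using z(2) by (auto simp: vec_eq_iff less_eq_vec_def)
  then have "component (z \<otimes> r) 0 = \<zero>" using component_mult_homogeneous[OF z(1) lr(2)] by simp
  moreover have "component \<one> 0 = \<one>" using component_homogeneous[OF one_homogeneous] by simp
  moreover have "component \<one> 0 = component l 0 \<oplus> component (z \<otimes> r) 0"
    using component_add[of l "z \<otimes> r" 0] lr(1,2) zc M.Icarr
    unfolding lr(3)[symmetric] by blast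
  ultimately have "\<one> = component l 0"
    using component_closed[of l 0] lr(1) M.Icarr by simp
  then have "\<one> \<in> M" using component_homogeneous_ideal[OF M(2) lr(1)] by metis
  then show False using M.one_imp_carrier M.I_notcarr by simp
qed

end

locale noetherian_multigraded_ring = multigraded_ring + noetherian_cring
begin

text \<open>
  For a nonunit \<open>u\<close> of degree zero, \<open>u\<close> and the homogeneous elements of nonzero degree generate a
  proper ideal, because the degree zero components of its elements are multiples of \<open>u\<close>. A maximal
  ideal above it contains everything of nonzero degree and is therefore homogeneous, so it is \<open>\<mm>\<close>.
\<close>

lemma degree_zero_unit:
  assumes \<mm>: "graded_local R grade \<mm>"
    and u: "u \<in> grade 0" "u \<notin> \<mm>"
  shows "\<exists>v\<in>carrier R. v \<otimes> u = \<one>"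
proof (rule ccontr)
  assume nonunit: "\<not> ?thesis"
  let ?G = "insert u (\<Union>e\<in>-{0}. grade e)"
  have uc: "u \<in> carrier R" using u grade_carrier by blast
  have G: "?G \<subseteq> (\<Union>d. grade d)" "?G \<subseteq> carrier R" using u grade_carrier by blast+
  have "\<one> \<notin> Idl ?G"
  proof
    assume "\<one> \<in> Idl ?G"
    have "component \<one> 0 \<in> PIdl u"
    proof (rule component_genideal[OF G(1) _ _ \<open>\<one> \<in> Idl ?G\<close>, where E = "{0}"])
      show "ideal (PIdl u) R" using uc by (rule cgenideal_ideal)
      fix g f r e
      assume g: "g \<in> ?G" "g \<in> grade f" and r: "r \<in> carrier R" and e: "e \<in> {0}" "f \<le> e"
      have f: "f = 0" using e by (auto simp: vec_eq_iff less_eq_vec_def)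
      show "g \<otimes> component r (e - f) \<in> PIdl u"
      proof (cases "g = u")
        case True
        have "g \<otimes> component r (e - f) = component r (e - f) \<otimes> u"
          unfolding True using uc component_closed[OF r] by (rule m_comm)
        then show ?thesis using component_closed[OF r] unfolding cgenideal_def by blast
      next
        case False
        \<comment> \<open>\<open>g\<close> is homogeneous both of degree zero and of a nonzero degree.\<close>
        then obtain e' where "g \<in> grade e'" "e' \<noteq> 0" using g by auto
        then have "g = \<zero>"
          using g(2) f component_homogeneous[of g 0 0] component_homogeneous[of g e' 0] by simp
        then have "g \<otimes> component r (e - f) = \<zero> \<otimes> u" using r uc component_closed by simp
        then show ?thesis unfolding cgenideal_def by blast
      qed
    qed simp
    then show False
      using nonunit component_homogeneous[OF one_homogeneous, of 0]
      by (auto simp: cgenideal_def)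
  qed
  then obtain M where M: "maximalideal M R" "Idl ?G \<subseteq> M"
    using proper_ideal_in_maximalideal genideal_ideal[OF G(2)] by blast
  interpret M: maximalideal M R by fact
  have GM: "?G \<subseteq> M" using genideal_self[OF G(2)] M(2) by blast
  have "homogeneous_ideal R grade M"
  proof (rule homogeneous_idealI[OF M.is_ideal])
    fix z e assume z: "z \<in> M"
    have zc: "z \<in> carrier R" using z M.Icarr by blast
    have pos: "component z d \<in> M" if "d \<noteq> 0" for d
      using GM component_props(1)[OF zc] that by blast
    define y where "y = z \<oplus> \<ominus> component z 0"
    have z0: "component z 0 \<in> grade 0" "component z 0 \<in> carrier R"
      using component_props(1)[OF zc] component_closed[OF zc] by auto
    have m0: "\<ominus> component z 0 \<in> grade 0"
      using additive_subgroup.a_inv_closed[OF grade_subgroup z0(1)] .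
    have "component y d \<in> M" for d
      using component_add[OF zc a_inv_closed[OF z0(2)], of d] component_homogeneous[OF m0, of d]
        pos[of d] z0 component_closed[OF zc] M.zero_closed
      by (cases "d = 0") (auto simp: y_def r_neg)
    then have "y \<in> M" using components_in_ideal[OF M.is_ideal] zc z0 by (simp add: y_def)
    then have "z \<oplus> \<ominus> y \<in> M" using z M.a_closed M.a_inv_closed by blast
    also have "z \<oplus> \<ominus> y = component z 0"
      using zc z0 by (simp add: y_def minus_add a_assoc[symmetric] r_neg)
    finally show "component z e \<in> M" using pos by (cases "e = 0") auto
  qed
  then have "M \<in> {\<mm>}" using \<mm> M(1) unfolding graded_local_def by blast
  then show False using GM u(2) by blast
qed

section \<open>Homogeneous elements of large degree\<close>

text \<open>
  Noetherian induction over the homogeneous ideals containing \<open>I\<close>. A maximal counterexample \<open>L\<close> misses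
  some homogeneous \<open>y\<close> of positive \<open>i\<close>-degree, and \<open>L + y R\<close> has a bound \<open>B\<close>. A homogeneous element of
  degree \<open>e\<close> with large \<open>e\<^sub>i\<close> is then modulo \<open>L\<close> a multiple \<open>y r\<close> with \<open>r\<close> of degree \<open>e - deg y\<close>, and
  repeating this \<open>t\<close> times makes it a multiple of \<open>y\<^sup>t \<in> I\<close>. So \<open>L\<close> has a bound too.
\<close>

lemma large_degree_in_ideal:
  assumes I: "ideal I R" and hom: "\<And>z e. z \<in> I \<Longrightarrow> component z e \<in> I"
    and rad: "\<And>z e. z \<in> grade e \<Longrightarrow> 0 < e $ i \<Longrightarrow> \<exists>t::nat. z [^] t \<in> I"
  shows "\<exists>B. \<forall>e. B < e $ i \<longrightarrow> grade e \<subseteq> I"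
proof (rule ccontr)
  assume bad: "\<not> ?thesis"
  let ?good = "\<lambda>L. \<exists>B. \<forall>e. B < e $ i \<longrightarrow> grade e \<subseteq> L"
  let ?F = "{L. ideal L R \<and> I \<subseteq> L \<and> (\<forall>z\<in>L. \<forall>e. component z e \<in> L) \<and> \<not> ?good L}"
  have "I \<in> ?F" using I hom bad by simp
  then obtain L where "L \<in> ?F" and max: "\<And>J. J \<in> ?F \<Longrightarrow> L \<subseteq> J \<Longrightarrow> J = L"
    by (rule maximal_ideal_in_family, simp) (rule that)
  then have L: "ideal L R" "I \<subseteq> L" "\<not> ?good L" and Lhom: "\<And>z e. z \<in> L \<Longrightarrow> component z e \<in> L"
    by auto
  interpret L: ideal L R by (rule L)
  obtain y f where y: "y \<in> grade f" "0 < f $ i" "y \<notin> L" using L(3) by blast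
  have yc: "y \<in> carrier R" using y grade_carrier by blast
  let ?J = "{l \<oplus> y \<otimes> r | l r. l \<in> L \<and> r \<in> carrier R}"
  have component_J: "\<exists>l'\<in>L. component z e = (if f \<le> e then l' \<oplus> y \<otimes> component r (e - f) else l')"
    if "z = l \<oplus> y \<otimes> r" "l \<in> L" "r \<in> carrier R" for z l r e
    using that component_add[of l "y \<otimes> r" e] component_mult_homogeneous[OF y(1) that(3), of e]
      Lhom[OF that(2), of e] L.Icarr yc
    by (intro bexI[of _ "component l e"]) auto
  have "\<exists>B. \<forall>e. B < e $ i \<longrightarrow> grade e \<subseteq> ?J"
  proof (rule ccontr)
    assume notgood: "\<not> ?thesis"
    have "component z e \<in> ?J" if z: "z \<in> ?J" for z e
    proof -
      from z obtain l r where lr: "z = l \<oplus> y \<otimes> r" "l \<in> L" "r \<in> carrier R" by blast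
      obtain l' where "l' \<in> L"
        "component z e = (if f \<le> e then l' \<oplus> y \<otimes> component r (e - f) else l')"
        using component_J[OF lr, of e] by blast
      then show ?thesis
        using ideal_plus_principal(2)[OF L(1) yc] component_closed[OF lr(3), of "e - f"]
        by (cases "f \<le> e") auto
    qed
    then have "?J \<in> ?F"
      using ideal_plus_principal(1,2)[OF L(1) yc] L(2) notgood by blast
    then have "?J = L" using max ideal_plus_principal(2)[OF L(1) yc] by blast
    then show False using ideal_plus_principal(3)[OF L(1) yc] y(3) by simp
  qed
  then obtain B where B: "\<And>e. B < e $ i \<Longrightarrow> grade e \<subseteq> ?J" by blast
  obtain t where t: "y [^] (t::nat) \<in> L" using rad[OF y(1,2)] L(2) by blast
  \<comment> \<open>Each step in degree buys one factor \<open>y\<close>; at \<open>j = t\<close> no factor is left to pay for.\<close>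
  have "y [^] (t - j) \<otimes> z \<in> L" if "j \<le> t" "B + j * f $ i < e $ i" "z \<in> grade e" for j e z
    using that
  proof (induction j arbitrary: e z)
    case 0
    then show ?case using t L.I_r_closed grade_carrier by simp
  next
    case (Suc j)
    have "z \<in> ?J" using B[of e] Suc.prems(2,3) by auto
    then obtain l r where lr: "z = l \<oplus> y \<otimes> r" "l \<in> L" "r \<in> carrier R" by blast
    obtain l' where l': "l' \<in> L"
      "component z e = (if f \<le> e then l' \<oplus> y \<otimes> component r (e - f) else l')"
      using component_J[OF lr, of e] by blast
    have z: "component z e = z" using component_homogeneous[OF Suc.prems(3)] by simp
    have powc: "y [^] (t - Suc j) \<in> carrier R" using yc by simp
    have l'': "y [^] (t - Suc j) \<otimes> l' \<in> L" using l'(1) powc L.I_l_closed by blast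
    show ?case
    proof (cases "f \<le> e")
      case False
      then show ?thesis using z l' l'' by simp
    next
      case True
      define r' where "r' = component r (e - f)"
      have r': "r' \<in> grade (e - f)" "r' \<in> carrier R"
        using component_props(1) component_closed lr(3) by (auto simp: r'_def)
      have "B + j * f $ i < (e - f) $ i" using Suc.prems(2) by simp
      then have "y [^] (t - j) \<otimes> r' \<in> L" using Suc.IH[OF _ _ r'(1)] Suc.prems(1) by simp
      moreover have "y [^] (t - j) = y [^] (t - Suc j) \<otimes> y"
        using Suc_diff_Suc[of j t] Suc.prems(1) nat_pow_Suc[of y "t - Suc j"] by simp
      moreover have "z = l' \<oplus> y \<otimes> r'" using z l'(2) True by (simp add: r'_def)
      ultimately show ?thesis
        using l'' powc yc r'(2) L.Icarr[OF l'(1)] L.a_closed by (simp add: r_distr m_assoc)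
    qed
  qed
  from this[of t] have "z \<in> L" if "B + t * f $ i < e $ i" "z \<in> grade e" for e z
    using that grade_carrier by simp
  then show False using L(3) by blast
qed

text \<open>
  A homogeneous element of degree \<open>e\<close> in the ideal is a combination of generators \<open>g\<close> with
  homogeneous coefficients of degree \<open>e - deg g\<close>. Passing to the coefficients lowers the \<open>i\<close>-degree by at
  most \<open>b\<close> and gains one factor of the ideal.
\<close>

lemma large_degree_in_ideal_power:
  assumes G: "G \<subseteq> (\<Union>d\<in>{d. d $ i \<le> b}. grade d)"
    and B: "\<And>e. B < e $ i \<Longrightarrow> grade e \<subseteq> Idl G"
    and e: "B + m * b < e $ i"
  shows "grade e \<subseteq> Idl G [^]\<^bsub>ideals_set R\<^esub> m"
  using e
proof (induction m arbitrary: e)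
  case 0
  then show ?case using grade_carrier by auto
next
  case (Suc m)
  have Gc: "G \<subseteq> carrier R" using G grade_carrier by blast
  have I: "ideal (Idl G) R" using Gc by (rule genideal_ideal)
  show ?case
  proof
    fix z assume z: "z \<in> grade e"
    have "component z e \<in> Idl G [^]\<^bsub>ideals_set R\<^esub> Suc m"
    proof (rule component_genideal[where G = G and E = "{e. B + Suc m * b < e $ i}"])
      show "G \<subseteq> (\<Union>d. grade d)" using G by blast
      show "ideal (Idl G [^]\<^bsub>ideals_set R\<^esub> Suc m) R" using I by (rule ideal_power_ideal)
      show "z \<in> Idl G" using B[of e] Suc.prems z by auto
      show "e \<in> {e. B + Suc m * b < e $ i}" using Suc.prems by simp
      fix g f r e
      assume g: "g \<in> G" "g \<in> grade f" and r: "r \<in> carrier R"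
        and e: "e \<in> {e. B + Suc m * b < e $ i}" "f \<le> e"
      have gI: "g \<in> Idl G" using g genideal_self[OF Gc] by blast
      show "g \<otimes> component r (e - f) \<in> Idl G [^]\<^bsub>ideals_set R\<^esub> Suc m"
      proof (cases "g = \<zero>")
        case True
        then show ?thesis
          using ideal_power_ideal[OF I, of "Suc m"] component_closed[OF r]
          by (simp add: ideal_def additive_subgroup.zero_closed)
      next
        case False
        obtain d where d: "d $ i \<le> b" "g \<in> grade d" using G g by blast
        have "d = f"
          using component_homogeneous[OF d(2), of d] component_homogeneous[OF g(2), of d] False
          by (auto split: if_splits)
        then have "B + m * b < (e - f) $ i" using d(1) e by simp
        then have "component r (e - f) \<in> Idl G [^]\<^bsub>ideals_set R\<^esub> m"
          using Suc.IH component_props(1)[OF r] by blast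
        then have "component r (e - f) \<otimes> g \<in> Idl G [^]\<^bsub>ideals_set R\<^esub> Suc m"
          using gI I by (simp add: ideal_prod.prod)
        then show ?thesis using grade_carrier[OF g(2)] component_closed[OF r] by (simp add: m_comm)
      qed
    qed
    then show "z \<in> Idl G [^]\<^bsub>ideals_set R\<^esub> Suc m" using component_homogeneous[OF z] by simp
  qed
qed

section \<open>Weak closure\<close>

text \<open>
  Some \<open>w\<^sup>n x\<^sup>n\<close> vanishes. Since \<open>w\<^sup>n \<notin> \<mm>\<close> and \<open>\<mm>\<close> contains everything of nonzero degree, the degree
  zero component of \<open>w\<^sup>n\<close> is a unit, and it kills the homogeneous element \<open>x\<^sup>n\<close>.
\<close>

lemma nilpotent_if_prime_radical_mult:
  assumes \<mm>: "graded_local R grade \<mm>"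
    and w: "w \<in> carrier R" "w \<notin> \<mm>"
    and x: "x \<in> grade d" and wx: "w \<otimes> x \<in> prime_radical"
  shows "\<exists>n::nat. x [^] n = \<zero>"
proof -
  have max: "maximalideal \<mm> R" "homogeneous_ideal R grade \<mm>"
    using \<mm> unfolding graded_local_def by blast+
  interpret \<mm>: primeideal \<mm> R using maximalideal_prime[OF max(1)] .
  have xc: "x \<in> carrier R" using x grade_carrier by blast
  obtain n where n: "(w \<otimes> x) [^] (n::nat) = \<zero>" using nilpotent_if_prime_radical[OF wx] by blast
  define v where "v = w [^] n"
  have v: "v \<in> carrier R" "v \<notin> \<mm>"
    using w(1) contrapos_nn[OF w(2) \<mm>.pow_mem[OF w(1)]] by (simp_all add: v_def)
  define u where "u = component v 0"
  have u: "u \<in> grade 0" using component_props(1)[OF v(1)] by (simp add: u_def)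
  have "u \<notin> \<mm>"
  proof
    assume "u \<in> \<mm>"
    then have "component v e \<in> \<mm>" for e
      using grade_nonzero_in_maximalideal[OF max component_props(1)[OF v(1)]]
      by (cases "e = 0") (auto simp: u_def)
    then show False using components_in_ideal[OF \<mm>.is_ideal v(1)] v(2) by blast
  qed
  then obtain u' where u': "u' \<in> carrier R" "u' \<otimes> u = \<one>" using degree_zero_unit[OF \<mm> u] by blast
  let ?d = "\<chi> i. n * d $ i"
  have "x [^] n \<otimes> v = \<zero>" using n w xc by (simp add: v_def nat_pow_distrib m_comm)
  then have "component (x [^] n \<otimes> v) ?d = \<zero>" using component_homogeneous[OF grade_zero] by simp
  moreover have "?d - ?d = 0" by (simp add: vec_eq_iff)
  ultimately have "x [^] n \<otimes> u = \<zero>"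
    using component_mult_homogeneous[OF grade_pow[OF x] v(1), of n ?d] by (simp add: u_def)
  moreover have "x [^] n = u' \<otimes> (x [^] n \<otimes> u)"
    using m_lcomm[OF u'(1) nat_pow_closed[OF xc] grade_carrier[OF u]] u'(2) xc by simp
  ultimately show ?thesis using u'(1) by auto
qed

text \<open>
  If \<open>I\<^sup>m\<close> has no regular element modulo the nilradical, then some \<open>w\<close> outside the nilradical
  multiplies \<open>I\<^sup>m\<close> into it, and \<open>\<mm>\<close> as well, since a power of every element of \<open>\<mm>\<close> lies in \<open>I\<^sup>m\<close>.
  This \<open>w\<close> is not in \<open>\<mm>\<close>, and it multiplies \<open>x\<close> into the nilradical.
\<close>

lemma nilpotent_or_regular_element_in_power:
  assumes \<mm>: "graded_local R grade \<mm>"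
    and I: "ideal I R" "ideal_radical R I = \<mm>"
    and x: "x \<in> grade d" "d \<noteq> 0"
  shows "(\<exists>n::nat. x [^] n = \<zero>) \<or>
    (\<exists>c \<in> I [^]\<^bsub>ideals_set R\<^esub> (m::nat). c \<in> avoiding_minimal_primes R)"
proof (cases "\<forall>w\<in>carrier R. (\<forall>y\<in>I [^]\<^bsub>ideals_set R\<^esub> m. w \<otimes> y \<in> prime_radical) \<longrightarrow> w \<in> prime_radical")
  case True
  then obtain c where "c \<in> I [^]\<^bsub>ideals_set R\<^esub> m"
    "\<And>w. w \<in> carrier R \<Longrightarrow> w \<otimes> c \<in> prime_radical \<Longrightarrow> w \<in> prime_radical"
    using regular_element_mod_prime_radical[OF ideal_power_ideal[OF I(1), of m]] by blast
  then show ?thesis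
    using regular_mod_prime_radical_avoids_minimal_primes
      ideal.Icarr[OF ideal_power_ideal[OF I(1), of m]] by blast
next
  case False
  then obtain w where w: "w \<in> carrier R" "w \<notin> prime_radical"
    and ann: "\<And>y. y \<in> I [^]\<^bsub>ideals_set R\<^esub> m \<Longrightarrow> w \<otimes> y \<in> prime_radical" by blast
  have wy: "w \<otimes> y \<in> prime_radical" if y: "y \<in> \<mm>" for y
  proof -
    have yc: "y \<in> carrier R" using y I(2) by (auto simp: ideal_radical_def)
    obtain t where "y [^] (t::nat) \<in> I" using y I(2) by (auto simp: ideal_radical_def)
    then have "(y [^] t) [^] m \<in> I [^]\<^bsub>ideals_set R\<^esub> m" using I(1) by (intro pow_in_ideal_power)
    then have "w \<otimes> y [^] (t * m) \<in> prime_radical" using ann yc by (simp add: nat_pow_pow)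
    then show ?thesis using prime_radical_mult_pow[OF w(1) yc] by blast
  qed
  have "w \<notin> \<mm>"
  proof
    assume "w \<in> \<mm>"
    then have "\<one> \<otimes> w [^] (2::nat) \<in> prime_radical" using wy w(1) by (simp add: numeral_2_eq_2)
    then show False using prime_radical_mult_pow[OF one_closed w(1)] w by fastforce
  qed
  moreover have "x \<in> \<mm>"
    using grade_nonzero_in_maximalideal[OF _ _ x] \<mm> unfolding graded_local_def by blast
  ultimately show ?thesis using nilpotent_if_prime_radical_mult[OF \<mm> w(1) _ x(1)] wy by blast
qed

lemma ideal_power_subset_mixed_power:
  assumes "ideal I R"
  shows "I [^]\<^bsub>ideals_set R\<^esub> nat \<lceil>s * real q\<rceil> \<subseteq> mixed_power R s q I"
proof
  fix z assume z: "z \<in> I [^]\<^bsub>ideals_set R\<^esub> nat \<lceil>s * real q\<rceil>"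
  have "(\<lambda>f. f [^] q) ` I \<subseteq> carrier R" using ideal.Icarr[OF assms] by auto
  then have "\<zero> \<in> frobenius_power R I q"
    unfolding frobenius_power_def
    using genideal_ideal by (auto simp: ideal_def additive_subgroup.zero_closed)
  then have "z \<oplus> \<zero> \<in> mixed_power R s q I"
    unfolding mixed_power_def set_add_def' using z by blast
  then show "z \<in> mixed_power R s q I"
    using ideal.Icarr[OF ideal_power_ideal[OF assms] z] by simp
qed

theorem homogeneous_element_in_weak_closure:
  assumes \<mm>: "graded_local R grade \<mm>"
    and hom: "homogeneous_ideal R grade I" and rad: "ideal_radical R I = \<mm>"
    and gen: "generated_in_degree_at_most R grade \<delta> I"
    and s: "s \<ge> 0" and p: "p \<ge> (2::nat)"
    and x: "x \<in> grade d" "d \<noteq> 0"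
    and d: "\<forall>i. real (d $ i) \<ge> s * real (\<delta> $ i)"
  shows "x \<in> weak_closure R p s I"
proof -
  have I: "ideal I R" using hom by (simp add: homogeneous_ideal_def)
  have xc: "x \<in> carrier R" using x grade_carrier by blast
  obtain i where i: "d $ i > 0" using x(2) by (auto simp: vec_eq_iff)
  obtain G where G: "G \<subseteq> (\<Union>d\<in>{d. d \<le> \<delta>}. grade d)" "I = Idl G"
    using gen by (auto simp: generated_in_degree_at_most_def)
  have Gi: "G \<subseteq> (\<Union>d\<in>{d. d $ i \<le> \<delta> $ i}. grade d)"
    using G(1) by (fastforce simp: less_eq_vec_def)
  have "\<exists>t::nat. z [^] t \<in> I" if "z \<in> grade e" "0 < e $ i" for z e
  proof -
    have "e \<noteq> 0" using that(2) by auto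
    then have "z \<in> \<mm>"
      using grade_nonzero_in_maximalideal[OF _ _ that(1)] \<mm>
      unfolding graded_local_def by blast
    then show ?thesis using rad by (auto simp: ideal_radical_def)
  qed
  then obtain B where B: "\<And>e. B < e $ i \<Longrightarrow> grade e \<subseteq> I"
    using large_degree_in_ideal[OF I component_homogeneous_ideal[OF hom], of i] by blast
  have large: "\<forall>\<^sub>F e in sequentially. N < p ^ e" for N
  proof (rule eventually_sequentiallyI[of N])
    fix e assume "N \<le> e"
    also have "e < p ^ e" using p by (intro power_gt_expt) simp
    finally show "N < p ^ e" .
  qed
  from nilpotent_or_regular_element_in_power[OF \<mm> I rad x, of "B + 2"]
  consider n where "x [^] (n::nat) = \<zero>"
    | c where "c \<in> I [^]\<^bsub>ideals_set R\<^esub> (B + 2)" "c \<in> avoiding_minimal_primes R" by blast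
  then show ?thesis
  proof cases
    case (1 n)
    have one: "\<one> \<in> avoiding_minimal_primes R"
      using ideal.one_imp_carrier primeideal.I_notcarr
      by (fastforce simp: avoiding_minimal_primes_def minimal_primes_def primeideal_def)
    have "\<forall>\<^sub>F e in sequentially. \<one> \<otimes> x [^] (p ^ e) \<in> mixed_power R s (p ^ e) I"
      using large[of n]
    proof eventually_elim
      case (elim e)
      have "x [^] (p ^ e) = x [^] n \<otimes> x [^] (p ^ e - n)"
        using elim xc by (simp add: nat_pow_mult)
      then have "\<one> \<otimes> x [^] (p ^ e) = \<zero>" using 1 xc by simp
      also have "\<zero> \<in> I [^]\<^bsub>ideals_set R\<^esub> nat \<lceil>s * real (p ^ e)\<rceil>"
        using ideal_power_ideal[OF I] by (simp add: ideal_def additive_subgroup.zero_closed)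
      finally show ?case using ideal_power_subset_mixed_power[OF I] by blast
    qed
    then show ?thesis unfolding weak_closure_def using xc one by blast
  next
    case (2 c)
    have "\<forall>\<^sub>F e in sequentially. c \<otimes> x [^] (p ^ e) \<in> mixed_power R s (p ^ e) I"
      using large[of B]
    proof eventually_elim
      case (elim e)
      define q where "q = p ^ e"
      define M where "M = nat \<lceil>s * real q\<rceil> - (B + 2)"
      have "B + M * \<delta> $ i < q * d $ i"
      proof (cases "M = 0 \<or> \<delta> $ i = 0")
        case True
        have "B < q * 1" using elim by (simp add: q_def)
        also have "\<dots> \<le> q * d $ i" using i by (intro mult_le_mono2) simp
        finally show ?thesis using True by auto
      next
        case False
        \<comment> \<open>Rounding up costs less than one, and \<open>\<delta> $ i \<ge> 1\<close> turns what is left of \<open>B + 2\<close>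
          into enough degree to absorb \<open>B\<close> strictly.\<close>
        have "real M < s * real q - real B - 1"
          using False s unfolding M_def by linarith
        then have "real M * real (\<delta> $ i) \<le> (s * real q - real B - 1) * real (\<delta> $ i)"
          by (intro mult_right_mono) auto
        also have "\<dots> = real q * (s * real (\<delta> $ i)) - (real B + 1) * real (\<delta> $ i)"
          by (simp add: algebra_simps)
        also have "\<dots> \<le> real q * real (d $ i) - (real B + 1) * 1"
          using d False by (intro diff_mono mult_left_mono) auto
        finally have "real (B + M * \<delta> $ i) < real (q * d $ i)" by simp
        then show ?thesis by (simp only: of_nat_less_iff)
      qed
      then have "x [^] q \<in> I [^]\<^bsub>ideals_set R\<^esub> M"
        using large_degree_in_ideal_power[OF Gi, of B M "\<chi> i. q * d $ i"] B G(2) grade_pow[OF x(1), of q]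
        by auto
      then have "c \<otimes> x [^] q \<in> I [^]\<^bsub>ideals_set R\<^esub> (B + 2 + M)"
        using 2(1) ideal_power_mult[OF I] by blast
      moreover have "nat \<lceil>s * real q\<rceil> \<le> B + 2 + M" unfolding M_def by linarith
      ultimately have "c \<otimes> x [^] q \<in> I [^]\<^bsub>ideals_set R\<^esub> nat \<lceil>s * real q\<rceil>"
        using ideal_power_antimono[OF I] by blast
      then show ?case using ideal_power_subset_mixed_power[OF I] unfolding q_def by blast
    qed
    then show ?thesis unfolding weak_closure_def using xc 2(2) by blast
  qed
qed

end

lemma (in multigraded_algebra) multigraded_ring: "multigraded_ring R grade"
proof (intro multigraded_ring.intro multigraded_ring_axioms.intro)
  show "cring R" using algebra_axioms by (simp add: algebra_def)
  show "additive_subgroup (grade d) R" for d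
    using grade_submodule[of d] by (simp add: submodule_def additive_subgroupI)
qed (use grade_mult grade_decomposition in auto)

text \<open>Ensures that the powers \<open>p ^ e\<close> of the characteristic are unbounded.\<close>

lemma ring_char_field_ge_2:
  assumes "field k" "ring_char k > 0"
  shows "ring_char k \<ge> 2"
proof -
  interpret field k by fact
  let ?P = "\<lambda>n::nat. 0 < n \<and> [n] \<cdot>\<^bsub>k\<^esub> \<one>\<^bsub>k\<^esub> = \<zero>\<^bsub>k\<^esub>"
  have "\<exists>n. ?P n" using assms(2) by (auto simp: ring_char_def split: if_splits)
  moreover from this have "?P (LEAST n. ?P n)" by (rule LeastI_ex)
  ultimately have "[ring_char k] \<cdot>\<^bsub>k\<^esub> \<one>\<^bsub>k\<^esub> = \<zero>\<^bsub>k\<^esub>" by (simp add: ring_char_def)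
  then have "ring_char k \<noteq> 1" by auto
  then show ?thesis using assms(2) by simp
qed

theorem theorem3p3:
  fixes k :: "('k, 'b) ring_scheme"
    and R :: "('k, 'a, 'c) module_scheme"
    and grade :: "nat ^ 'n \<Rightarrow> 'a set"
    and \<mm> I :: "'a set"
    and \<delta> d :: "nat ^ 'n"
    and s :: real and p :: nat and x :: 'a
  assumes "field k" and "ring_char k = p" and "p > 0"
    and "noetherian_ring R"
    and "finitely_generated_algebra k R"
    and "multigraded_algebra k R grade"
    and "graded_local R grade \<mm>"
    and "homogeneous_ideal R grade I"
    and "primary_to R \<mm> I"
    and "generated_in_degree_at_most R grade \<delta> I"
    and "s \<ge> 1"
    and "x \<in> grade d" and "d \<noteq> 0"
    and "\<forall>i. real (d $ i) \<ge> s * real (\<delta> $ i)"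
  shows "x \<in> weak_closure R p s I"
proof -
  interpret multigraded_ring R grade
    using multigraded_algebra.multigraded_ring[OF assms(6)] .
  interpret noetherian_ring R by fact
  interpret noetherian_multigraded_ring R grade ..
  have "p \<ge> 2" using ring_char_field_ge_2 assms(1-3) by blast
  then show ?thesis
    using assms by (intro homogeneous_element_in_weak_closure) (auto simp: primary_to_def)
qed

end
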